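(* For every $(a,b)\in\mathcal H$, the map $f_{a,b}$ has exactly one attracting cycle.
   Context: Let $\mathbb T=\mathbb R/\mathbb Z$, identified with $[0,1]$ with $0\sim 1$. For $(a,b)\in\mathbb R/\mathbb Z\times[0,1]$ define $f_{a,b}:\mathbb T\to\mathbb T$ by $f_{a,b}(x)=\left(2x+a+\frac b2 S(x)\right)\bmod 1$, where $S(x)=4x-1$ for $x\in[0,\frac12]$ and $S(x)=-4x+3$ for $x\in[\frac12,1)$. A periodic cycle of exact period $p$ is attracting if each of its points has a neighbourhood all of whose points converge to it under iteration of $f_{a,b}^p$. The hyperbolic set is $\mathcal H=\{(a,b)\in\mathbb R/\mathbb Z\times[0,1): f_{a,b}\text{ has an attracting cycle}\}$. *)

theory Defs
  imports Complex_Main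
begin

quotient_type circle = real / "\<lambda>x y. x - y \<in> \<int>"
  morphisms rep_circle proj_circle
proof (rule equivpI)
  show "reflp (\<lambda>x y. x - y \<in> (\<int> :: real set))"
    by (simp add: reflp_def)
  show "symp (\<lambda>x y. x - y \<in> (\<int> :: real set))"
    by (metis (no_types, lifting) Ints_minus minus_diff_eq sympI)
  show "transp (\<lambda>x y. x - y \<in> (\<int> :: real set))"
  proof (rule transpI)
    fix x y z :: real
    assume "x - y \<in> \<int>" "y - z \<in> \<int>"
    then have "(x - y) + (y - z) \<in> \<int>" by (rule Ints_add)
    then show "x - z \<in> \<int>" by simp
  qed
qed

text \<open>The quotient topology on the circle.\<close>

instantiation circle :: topological_space
begin

definition open_circle :: "circle set \<Rightarrow> bool" where
  "open_circle U \<longleftrightarrow> open (proj_circle -` U)"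

instance
proof
  show "open (UNIV :: circle set)"
    by (simp add: open_circle_def)
next
  fix S T :: "circle set"
  assume "open S" "open T"
  then show "open (S \<inter> T)"
    by (simp add: open_circle_def vimage_Int open_Int)
next
  fix K :: "circle set set"
  assume "\<forall>S\<in>K. open S"
  then show "open (\<Union>K)"
    by (auto simp add: open_circle_def vimage_Union)
qed

end

definition S :: "real \<Rightarrow> real" where
  "S x = (if x \<le> 1/2 then 4 * x - 1 else - 4 * x + 3)"

text \<open>The function \<^term>\<open>S\<close> is only meaningful on \<open>[0, 1)\<close>, hence the fractional part
  of the representative below.\<close>

lift_definition f :: "circle \<Rightarrow> real \<Rightarrow> circle \<Rightarrow> circle" is
  "\<lambda>a b x. 2 * x + a + b / 2 * S (frac x)"
proof -
  fix a a' b x x' :: real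
  assume a: "a - a' \<in> \<int>" and x: "x - x' \<in> \<int>"
  from x obtain n :: int where n: "x - x' = of_int n"
    by (auto elim: Ints_cases)
  then have "x = x' + of_int n" by simp
  then have "frac x = frac x'"
    by (simp add: frac_def)
  moreover have "2 * (x - x') + (a - a') \<in> \<int>"
    using a x by (intro Ints_add Ints_mult) auto
  ultimately show "2 * x + a + b / 2 * S (frac x) - (2 * x' + a' + b / 2 * S (frac x')) \<in> \<int>"
    by (simp add: algebra_simps)
qed

text \<open>A cycle is identified with the set of its points.\<close>

definition periodic_cycle :: "('a \<Rightarrow> 'a) \<Rightarrow> nat \<Rightarrow> 'a set \<Rightarrow> bool" where
  "periodic_cycle g p C \<longleftrightarrow>
     0 < p \<and>
     (\<exists>x. (g ^^ p) x = x \<and> (\<forall>k. 0 < k \<and> k < p \<longrightarrow> (g ^^ k) x \<noteq> x) \<and>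
          C = (\<lambda>k. (g ^^ k) x) ` {..<p})"

definition attracting_cycle :: "('a::topological_space \<Rightarrow> 'a) \<Rightarrow> 'a set \<Rightarrow> bool" where
  "attracting_cycle g C \<longleftrightarrow>
     (\<exists>p. periodic_cycle g p C \<and>
          (\<forall>x\<in>C. \<exists>U. open U \<and> x \<in> U \<and>
             (\<forall>y\<in>U. (\<lambda>n. ((g ^^ p) ^^ n) y) \<longlonglongrightarrow> x)))"

definition hyperbolic_set :: "(circle \<times> real) set" where
  "hyperbolic_set = {(a, b). 0 \<le> b \<and> b < 1 \<and> (\<exists>C. attracting_cycle (f a b) C)}"

end

theory Submission
  imports Defs "HOL-Analysis.Elementary_Metric_Spaces"
begin

text \<open>
  Lifted to the line, the map is an increasing piecewise affine homeomorphism \<open>F\<close> with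
  \<open>F (x + 1) = F x + 2\<close>. Its slope alternates between \<open>2 + 2 b\<close> and \<open>2 - 2 b\<close>, with convex corners
  at the integers and concave corners at the half-integers. The point of the proof is that every
  attracting cycle attracts the concave corner \<open>1/2\<close>, as an attracting cycle of a rational map
  attracts a critical point. Limits on the circle are unique, so there is only one such cycle.

  To see that the corner is attracted, let \<open>x\<close> lie over a point of a cycle of period \<open>p\<close>, and
  let \<open>G\<close> be the integer translate of \<open>F ^^ p\<close> that fixes \<open>x\<close>. Attraction forces
  \<open>G y > y\<close> for \<open>y\<close> slightly to the left of \<open>x\<close> (lemma \<open>attracting_imp_above_diagonal\<close>). Since
  \<open>G\<close> lies below the diagonal at \<open>x - 1\<close>, there is a last point \<open>l < x\<close> with \<open>G l \<le> l\<close>, and the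
  graph of \<open>G\<close> is strictly above the diagonal on \<open>(l, x)\<close>. If none of the intervals
  \<open>F ^^ k\<close> \<open>(l, x)\<close> with \<open>k < p\<close> contained a half-integer, then \<open>F\<close> would be convex on each of
  them, so \<open>G\<close> would be convex on \<open>[l, x]\<close> as a composition of increasing convex functions, and its
  graph would stay below the chord from \<open>(l, G l)\<close> to \<open>(x, x)\<close>, hence below the diagonal. So
  some point of \<open>(l, x)\<close> is mapped onto a half-integer by some \<open>F ^^ k\<close>; its orbit under \<open>G\<close>
  increases to \<open>x\<close>, and therefore the orbit of the corner tends to the cycle.
\<close>

section \<open>The circle as a Hausdorff quotient\<close>

lemma proj_circle_eq_iff: "proj_circle x = proj_circle y \<longleftrightarrow> x - y \<in> \<int>"
  by (rule circle.abs_eq_iff)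

lemma proj_circle_diff_of_int [simp]: "proj_circle (x - of_int m) = proj_circle x"
  by (simp add: proj_circle_eq_iff)

lemma continuous_on_proj_circle: "continuous_on A proj_circle"
proof -
  have "continuous_on UNIV proj_circle"
    by (simp add: continuous_on_open_vimage open_circle_def)
  then show ?thesis
    by (rule continuous_on_subset) simp
qed

lemma tendsto_proj_circle:
  assumes "X \<longlonglongrightarrow> L"
  shows "(\<lambda>n. proj_circle (X n)) \<longlonglongrightarrow> proj_circle L"
  using continuous_on_tendsto_compose[OF continuous_on_proj_circle[of UNIV] assms] by simp

text \<open>The circle of complex numbers of modulus one serves to separate points: a continuous
  injection into a Hausdorff space makes limits in its domain unique.\<close>

lift_definition circle_embedding :: "circle \<Rightarrow> complex" is "\<lambda>x. cis (2 * pi * x)"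
proof -
  fix x y :: real
  assume "x - y \<in> \<int>"
  then obtain n where "x = y + of_int n"
    by (metis Ints_cases add.commute diff_add_cancel)
  then have "cis (2 * pi * x) = cis (2 * pi * y) * cis (2 * pi * of_int n)"
    by (simp add: distrib_left flip: cis_mult)
  then show "cis (2 * pi * x) = cis (2 * pi * y)"
    by (simp add: cis_multiple_2pi)
qed

lemma continuous_on_circle_embedding: "continuous_on UNIV circle_embedding"
proof -
  have "proj_circle -` (circle_embedding -` B) = (\<lambda>x. cis (2 * pi * x)) -` B" for B
    by (auto simp: circle_embedding.abs_eq)
  moreover have "continuous_on UNIV (\<lambda>x. cis (2 * pi * x))"
    by (intro continuous_intros)
  ultimately show ?thesis
    by (simp add: continuous_on_open_vimage open_circle_def)
qed

lemma inj_circle_embedding: "inj circle_embedding"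
proof (rule injI)
  fix u v :: circle
  assume eq: "circle_embedding u = circle_embedding v"
  obtain x y where xy: "u = proj_circle x" "v = proj_circle y"
    by (metis Quotient3_abs_rep Quotient3_circle)
  have "cis (2 * pi * x) = cis (2 * pi * y)"
    using eq by (simp add: xy circle_embedding.abs_eq)
  then have "sin (2 * pi * x) = sin (2 * pi * y) \<and> cos (2 * pi * x) = cos (2 * pi * y)"
    by (simp add: complex_eq_iff)
  then obtain n :: int where "2 * pi * x = 2 * pi * y + 2 * pi * of_int n"
    using sin_cos_eq_iff by (auto simp: mult_ac)
  then have "2 * pi * x = 2 * pi * (y + of_int n)"
    by (simp add: distrib_left)
  then have "x - y = of_int n"
    by simp
  then show "u = v"
    by (simp add: xy proj_circle_eq_iff)
qed

lemma circle_limit_unique: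
  fixes x y :: circle
  assumes "X \<longlonglongrightarrow> x" "X \<longlonglongrightarrow> y"
  shows "x = y"
proof -
  have "(\<lambda>n. circle_embedding (X n)) \<longlonglongrightarrow> circle_embedding z" if "X \<longlonglongrightarrow> z" for z
    using continuous_on_tendsto_compose[OF continuous_on_circle_embedding that] by simp
  then have "circle_embedding x = circle_embedding y"
    using assms LIMSEQ_unique by blast
  then show ?thesis
    using inj_circle_embedding by (simp add: inj_eq)
qed

section \<open>Cycles\<close>

text \<open>A cycle is determined by any one of its points, so two cycles that share a point are equal.\<close>

lemma periodic_cycle_point:
  assumes "periodic_cycle g p C" "x \<in> C"
  shows "(g ^^ p) x = x" and "C = range (\<lambda>k. (g ^^ k) x)"
proof -
  obtain x0 where p: "0 < p" and x0: "(g ^^ p) x0 = x0" and C: "C = (\<lambda>k. (g ^^ k) x0) ` {..<p}"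
    using assms(1) by (auto simp: periodic_cycle_def)
  obtain j where j: "j < p" "x = (g ^^ j) x0"
    using assms(2) C by auto
  have red: "(g ^^ (k mod p)) x0 = (g ^^ k) x0" for k
    by (rule funpow_mod_eq[OF x0])
  have shift: "(g ^^ k) x = (g ^^ (k + j)) x0" for k
    by (simp add: j funpow_add)
  have "(g ^^ p) x = (g ^^ (j + p)) x0"
    by (simp add: shift add.commute)
  then show "(g ^^ p) x = x"
    by (simp add: funpow_add x0 j)
  show "C = range (\<lambda>k. (g ^^ k) x)"
  proof (intro equalityI subsetI)
    fix z assume "z \<in> C"
    then obtain i where "z = (g ^^ i) x0"
      using C by auto
    also have "\<dots> = (g ^^ (i + p)) x0"
      by (simp add: funpow_add x0)
    also have "\<dots> = (g ^^ (i + (p - j))) x"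
      using j(1) by (simp add: shift)
    finally show "z \<in> range (\<lambda>k. (g ^^ k) x)"
      by blast
  next
    fix z assume "z \<in> range (\<lambda>k. (g ^^ k) x)"
    then obtain k where "z = (g ^^ ((k + j) mod p)) x0"
      by (auto simp: shift red)
    then show "z \<in> C"
      using p by (auto simp: C)
  qed
qed

section \<open>Increasing maps of the line and their fixed points\<close>

lemma isCont_funpow:
  fixes G :: "real \<Rightarrow> real"
  assumes "\<And>x. isCont G x"
  shows "isCont (G ^^ n) x"
proof (induction n)
  case 0
  show ?case
    by (simp add: id_def)
next
  case (Suc n)
  then show ?case
    using isCont_o2[OF Suc assms] by (simp add: o_def)
qed

lemma strict_mono_funpow:
  fixes G :: "real \<Rightarrow> real"
  assumes "strict_mono G"
  shows "strict_mono (G ^^ n)"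
  by (induction n) (auto simp: strict_mono_def assms[THEN strict_monoD])

lemma funpow_limit_fixed_point:
  fixes G :: "real \<Rightarrow> real"
  assumes "\<And>x. isCont G x" "(\<lambda>n. (G ^^ n) y) \<longlonglongrightarrow> L"
  shows "G L = L"
proof -
  have "(\<lambda>n. (G ^^ Suc n) y) \<longlonglongrightarrow> G L"
    using isCont_tendsto_compose[OF assms(1) assms(2)] by simp
  moreover have "(\<lambda>n. (G ^^ Suc n) y) \<longlonglongrightarrow> L"
    using assms(2) by (rule LIMSEQ_Suc)
  ultimately show ?thesis
    by (rule LIMSEQ_unique)
qed

lemma funpow_tendsto_next_fixed_point:
  fixes G :: "real \<Rightarrow> real"
  assumes cont: "\<And>x. isCont G x" and mono: "mono G" and x: "G x = x"
    and above: "\<And>z. l < z \<Longrightarrow> z < x \<Longrightarrow> z < G z" and y: "l < y" "y < x"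
  shows "(\<lambda>n. (G ^^ n) y) \<longlonglongrightarrow> x"
proof -
  have "G y \<ge> y"
    using above[OF y] by simp
  then have step: "(G ^^ n) y \<le> (G ^^ Suc n) y" for n
    by (induction n) (auto intro: monoD[OF mono])
  then have inc: "incseq (\<lambda>n. (G ^^ n) y)"
    by (rule incseq_SucI)
  have bound: "(G ^^ n) y \<le> x" for n
    by (induction n) (use y x monoD[OF mono] in \<open>auto, metis\<close>)
  obtain L where L: "(\<lambda>n. (G ^^ n) y) \<longlonglongrightarrow> L" "\<And>n. (G ^^ n) y \<le> L"
    using incseq_convergent[OF inc] bound by metis
  have "L \<le> x"
    using L(1) bound by (rule LIMSEQ_le_const2[OF _ exI, OF _ allI, OF _ impI])
  moreover have "l < L"
    using L(2)[of 0] y by simp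
  moreover have "G L = L"
    using cont L(1) by (rule funpow_limit_fixed_point)
  ultimately have "L = x"
    using above[of L] by force
  then show ?thesis
    using L(1) by simp
qed

text \<open>The composition of increasing convex functions is convex. Only the chord over the single
  pair \<open>u\<close>, \<open>v\<close> is followed, so convexity of \<open>F\<close> is required only between the points of
  their two orbits.\<close>

lemma funpow_below_chord:
  fixes F :: "real \<Rightarrow> real"
  assumes mono: "mono F" and t: "0 \<le> t" "t \<le> 1"
    and chord: "\<And>k. k < p \<Longrightarrow> F ((1 - t) * (F ^^ k) u + t * (F ^^ k) v)
                    \<le> (1 - t) * F ((F ^^ k) u) + t * F ((F ^^ k) v)"
  shows "(F ^^ p) ((1 - t) * u + t * v) \<le> (1 - t) * (F ^^ p) u + t * (F ^^ p) v"
  using chord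
proof (induction p)
  case 0
  then show ?case by simp
next
  case (Suc p)
  have "(F ^^ p) ((1 - t) * u + t * v) \<le> (1 - t) * (F ^^ p) u + t * (F ^^ p) v"
    using Suc by simp
  then have "(F ^^ Suc p) ((1 - t) * u + t * v) \<le> F ((1 - t) * (F ^^ p) u + t * (F ^^ p) v)"
    by (simp add: monoD[OF mono])
  also have "\<dots> \<le> (1 - t) * (F ^^ Suc p) u + t * (F ^^ Suc p) v"
    using Suc.prems[of p] by simp
  finally show ?case .
qed

section \<open>Attraction seen in the line\<close>

lemma proj_circle_funpow:
  assumes "\<And>x. proj_circle (G x) = g (proj_circle x)"
  shows "proj_circle ((G ^^ n) x) = (g ^^ n) (proj_circle x)"
  by (induction n) (simp_all add: assms)

text \<open>Suppose \<open>G y \<le> y\<close> for some \<open>y < x\<close> over the neighbourhood \<open>U\<close>. The orbit of \<open>y\<close> then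
  decreases. If it is bounded below, its limit is a fixed point of \<open>G\<close> other than \<open>x\<close>; it cannot
  lie over the same point of the circle, because \<open>x\<close> is the only one of its integer translates
  that \<open>G\<close> fixes. If it is unbounded, local information does not suffice, since points that
  are repelled from \<open>x\<close> on the line may come back to it around the circle. But then the images
  of \<open>[y, x]\<close> eventually cover every \<open>w < x\<close>. Taking \<open>w\<close> over another point of period at most
  two gives a point of \<open>U\<close> that is not attracted.\<close>

lemma attracting_imp_above_diagonal:
  fixes G :: "real \<Rightarrow> real" and d :: int
  assumes lift: "\<And>x. proj_circle (G x) = g (proj_circle x)"
    and cont: "\<And>x. isCont G x" and mono: "mono G"
    and shift: "\<And>x k. G (x + of_int k) = G x + of_int (d * k)" and d: "2 \<le> d"
    and x: "G x = x"
    and U: "open U" "proj_circle x \<in> U"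
    and conv: "\<And>u. u \<in> U \<Longrightarrow> (\<lambda>n. (g ^^ n) u) \<longlonglongrightarrow> proj_circle x"
  shows "\<exists>e>0. \<forall>y. x - e < y \<and> y < x \<longrightarrow> y < G y"
proof -
  have "open (proj_circle -` U)" "x \<in> proj_circle -` U"
    using U by (auto simp: open_circle_def)
  then obtain e where e: "e > 0" "\<And>y. dist y x < e \<Longrightarrow> proj_circle y \<in> U"
    by (auto simp: open_dist)
  \<comment> \<open>As \<open>G (x + k) = x + d k\<close> with \<open>d \<noteq> 1\<close>, only \<open>k = 0\<close> gives a fixed point.\<close>
  have other_lifts: "l = x" if fixed: "G l = l" and eq: "proj_circle l = proj_circle x" for l
  proof -
    obtain k where k: "l = x + of_int k"
      using eq by (metis Ints_cases add.commute diff_add_cancel proj_circle_eq_iff)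
    have "of_int (d * k) = (of_int k :: real)"
      using fixed shift[of x k] by (simp add: k x)
    then have "d * k = k"
      by (simp only: of_int_eq_iff)
    then show ?thesis
      using d by (simp add: k)
  qed
  have "y < G y" if y: "x - e < y" "y < x" for y
  proof (rule ccontr)
    assume "\<not> y < G y"
    then have "G y \<le> y" by simp
    then have "(G ^^ Suc n) y \<le> (G ^^ n) y" for n
      by (induction n) (auto intro: monoD[OF mono])
    then have dec: "decseq (\<lambda>n. (G ^^ n) y)"
      by (rule decseq_SucI)
    show False
    proof (cases "\<exists>B. \<forall>n. B \<le> (G ^^ n) y")
      case True
      then obtain L where L: "(\<lambda>n. (G ^^ n) y) \<longlonglongrightarrow> L" "\<And>n. L \<le> (G ^^ n) y"
        using decseq_convergent[OF dec] by metis
      have "(\<lambda>n. (g ^^ n) (proj_circle y)) \<longlonglongrightarrow> proj_circle L"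
        using tendsto_proj_circle[OF L(1)] by (simp add: proj_circle_funpow[of G, OF lift])
      moreover have "(\<lambda>n. (g ^^ n) (proj_circle y)) \<longlonglongrightarrow> proj_circle x"
        using y by (intro conv e(2)) (simp add: dist_real_def)
      ultimately have "proj_circle L = proj_circle x"
        by (rule circle_limit_unique)
      then have "L = x"
        using other_lifts funpow_limit_fixed_point[OF cont L(1)] by blast
      then show False
        using L(2)[of 0] y by simp
    next
      case False
      \<comment> \<open>A zero of \<open>H + 1\<close> is mapped by \<open>G \<circ> G\<close> to its translate by \<open>-1\<close>, so it lies over a
        periodic point. The second iterate is needed: for \<open>d = 2\<close> the displacement of \<open>G\<close>
        itself takes the value \<open>-1\<close> at \<open>x - 1\<close>, and the point found could lie over that of \<open>x\<close>.\<close>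
      define H where "H = (\<lambda>z. G (G z) - z)"
      have "H (x - 1) = 1 - of_int (d * d)"
      proof -
        have "G (x - 1) = x + of_int (- d)"
          using shift[of x "-1"] by (simp add: x)
        then show ?thesis
          using shift[of x "- d"] by (simp add: H_def x)
      qed
      moreover have "4 \<le> d * d"
        using mult_mono[OF d d] d by simp
      then have "4 \<le> (of_int (d * d) :: real)"
        by linarith
      ultimately have H1: "H (x - 1) < -1"
        by linarith
      have H0: "H x = 0"
        by (simp add: H_def x)
      have "isCont H z" for z
        unfolding H_def by (intro continuous_intros isCont_o2[OF cont cont])
      then have "continuous_on {x - 1..x} H"
        by (simp add: continuous_at_imp_continuous_on)
      then obtain w where w: "x - 1 \<le> w" "w \<le> x" "H w = -1"
        using IVT'[of H "x - 1" "-1" x] H0 H1 by auto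
      have w': "x - 1 < w" "w < x"
        using w H0 H1 by (auto simp: order.order_iff_strict)
      obtain n where "(G ^^ n) y < w"
        using False by (meson not_le)
      moreover have "(G ^^ n) x = x"
        by (induction n) (simp_all add: x)
      moreover have "continuous_on {y..x} (G ^^ n)"
        by (simp add: continuous_at_imp_continuous_on isCont_funpow cont)
      ultimately obtain z where z: "y \<le> z" "z \<le> x" "(G ^^ n) z = w"
        using IVT'[of "G ^^ n" y w x] y w' by auto
      have "(\<lambda>m. (g ^^ m) (proj_circle z)) \<longlonglongrightarrow> proj_circle x"
        using y z by (intro conv e(2)) (simp add: dist_real_def)
      then have "(\<lambda>m. (g ^^ (2 * m + n)) (proj_circle z)) \<longlonglongrightarrow> proj_circle x"
        by (rule LIMSEQ_subseq_LIMSEQ[unfolded comp_def]) (simp add: strict_mono_def)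
      moreover have "(g ^^ (2 * m + n)) (proj_circle z) = proj_circle w" for m
      proof (induction m)
        case 0
        show ?case
          using z by (simp flip: proj_circle_funpow[of G, OF lift])
      next
        case (Suc m)
        have "G (G w) = w - of_int 1"
          using w by (simp add: H_def)
        then have "g (g (proj_circle w)) = proj_circle w"
          by (metis lift proj_circle_diff_of_int)
        then show ?case
          using Suc by simp
      qed
      ultimately have "proj_circle w = proj_circle x"
        using circle_limit_unique[OF tendsto_const] by simp
      then obtain k :: int where "x - w = of_int k"
        by (metis Ints_cases proj_circle_eq_iff)
      then show False
        using w' by (auto simp: algebra_simps)
    qed
  qed
  then show ?thesis
    using e(1) by blast
qed

section \<open>The lift of the map and its corners\<close>

text \<open>\<open>S (frac x)\<close> is \<open>4 d - 1\<close>, where \<open>d\<close> is the distance from \<open>x\<close> to the nearest integer. This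
  gives the Lipschitz constant 4 and the convexity between consecutive half-integers.\<close>

lemma S_frac_le: "S (frac x) \<le> 4 * \<bar>x - of_int n\<bar> - 1"
proof (cases "n \<le> \<lfloor>x\<rfloor>")
  case True
  then have "of_int n \<le> (of_int \<lfloor>x\<rfloor> :: real)" by simp
  then have "frac x \<le> \<bar>x - of_int n\<bar>"
    unfolding frac_def by (intro order_trans[OF _ abs_ge_self]) simp
  moreover have "S (frac x) \<le> 4 * frac x - 1"
    by (simp add: S_def)
  ultimately show ?thesis
    by argo
next
  case False
  then have "of_int n \<ge> (of_int (\<lfloor>x\<rfloor> + 1) :: real)"
    by (simp del: of_int_add)
  then have "1 - frac x \<le> \<bar>x - of_int n\<bar>"
    unfolding frac_def by (intro order_trans[OF _ abs_ge_minus_self]) simp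
  moreover have "S (frac x) \<le> 3 - 4 * frac x"
    by (simp add: S_def)
  ultimately show ?thesis
    by argo
qed

lemma S_frac_eq:
  assumes "of_int n - 1/2 \<le> x" "x \<le> of_int n + 1/2"
  shows "S (frac x) = 4 * \<bar>x - of_int n\<bar> - 1"
proof (cases "of_int n \<le> x")
  case True
  then have "\<lfloor>x\<rfloor> = n"
    using assms by (simp add: floor_eq_iff)
  then show ?thesis
    using assms True by (simp add: S_def frac_def)
next
  case False
  then have "\<lfloor>x\<rfloor> = n - 1"
    using assms by (simp add: floor_eq_iff)
  then show ?thesis
    using assms False by (simp add: S_def frac_def)
qed

lemma S_frac_lipschitz: "\<bar>S (frac x) - S (frac y)\<bar> \<le> 4 * \<bar>x - y\<bar>"
proof -
  have "S (frac x) - S (frac y) \<le> 4 * \<bar>x - y\<bar>" for x y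
  proof -
    define n where "n = \<lfloor>y + 1/2\<rfloor>"
    have "S (frac y) = 4 * \<bar>y - of_int n\<bar> - 1"
      unfolding n_def by (rule S_frac_eq) linarith+
    moreover have "\<bar>x - of_int n\<bar> \<le> \<bar>x - y\<bar> + \<bar>y - of_int n\<bar>"
      by simp
    ultimately show ?thesis
      using S_frac_le[of x n] by argo
  qed
  from this[of x y] this[of y x] show ?thesis
    by (simp add: abs_le_iff abs_minus_commute)
qed

definition lift_f :: "real \<Rightarrow> real \<Rightarrow> real \<Rightarrow> real" where
  "lift_f a b x = 2 * x + a + b / 2 * S (frac x)"

lemma proj_circle_lift_f: "proj_circle (lift_f a b x) = f (proj_circle a) b (proj_circle x)"
  by (simp add: lift_f_def f.abs_eq)

lemma lift_f_add_of_int: "lift_f a b (x + of_int k) = lift_f a b x + of_int (2 * k)"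
  by (simp add: lift_f_def)

lemma funpow_lift_f_add_of_int:
  "(lift_f a b ^^ n) (x + of_int k) = (lift_f a b ^^ n) x + of_int (2 ^ n * k)"
proof (induction n)
  case 0
  show ?case by simp
next
  case (Suc n)
  have "(lift_f a b ^^ Suc n) (x + of_int k) = lift_f a b ((lift_f a b ^^ n) x + of_int (2 ^ n * k))"
    using Suc by simp
  also have "\<dots> = (lift_f a b ^^ Suc n) x + of_int (2 * (2 ^ n * k))"
    by (simp only: lift_f_add_of_int funpow.simps o_apply)
  finally show ?case
    by (simp add: mult.assoc)
qed

lemma isCont_lift_f: "isCont (lift_f a b) x"
proof -
  have "((\<lambda>y. S (frac y) - S (frac x)) \<longlongrightarrow> 0) (at x)"
  proof (rule tendsto_0_le)
    show "((\<lambda>y. y - x) \<longlongrightarrow> 0) (at x)"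
      by (simp add: LIM_zero)
    show "\<forall>\<^sub>F y in at x. norm (S (frac y) - S (frac x)) \<le> norm (y - x) * 4"
      using S_frac_lipschitz by (simp add: mult.commute)
  qed
  then have "isCont (\<lambda>y. S (frac y)) x"
    by (simp add: isCont_def LIM_zero_iff)
  then show ?thesis
    unfolding lift_f_def by (intro continuous_intros)
qed

text \<open>The perturbation has Lipschitz constant \<open>2 b\<close>, which is less than the slope 2 of the
  doubling map.\<close>

lemma strict_mono_lift_f:
  assumes "0 \<le> b" "b < 1"
  shows "strict_mono (lift_f a b)"
proof (rule strict_monoI)
  fix x y :: real
  assume xy: "x < y"
  have "S (frac x) - S (frac y) \<le> 4 * (y - x)"
    using S_frac_lipschitz[of x y] xy by (simp add: abs_le_iff)
  then have "b / 2 * (S (frac x) - S (frac y)) \<le> b / 2 * (4 * (y - x))"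
    using assms by (intro mult_left_mono) auto
  also have "\<dots> < 2 * (y - x)"
    using assms xy by simp
  finally show "lift_f a b x < lift_f a b y"
    by (simp add: lift_f_def algebra_simps)
qed

text \<open>An interval without half-integers in its interior contains at most one convex corner, where the
  lift is an affine function plus \<open>2 b \<bar>z - n\<bar>\<close>.\<close>

lemma lift_f_below_chord:
  assumes b: "0 \<le> b" and t: "0 \<le> t" "t \<le> 1" and uv: "u \<le> v"
    and no_corner: "\<And>n. \<not> (u < of_int n + 1/2 \<and> of_int n + 1/2 < v)"
  shows "lift_f a b ((1 - t) * u + t * v) \<le> (1 - t) * lift_f a b u + t * lift_f a b v"
proof (cases "u = v")
  case True
  then show ?thesis by (simp add: algebra_simps)
next
  case False
  define n where "n = \<lfloor>u + 1/2\<rfloor>"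
  have n: "of_int n - 1/2 \<le> u" "u < of_int n + 1/2"
    unfolding n_def by linarith+
  then have v: "v \<le> of_int n + 1/2"
    using no_corner[of n] by simp
  have S: "S (frac z) = 4 * \<bar>z - of_int n\<bar> - 1" if "u \<le> z" "z \<le> v" for z
    using that n v by (intro S_frac_eq) auto
  define c where "c = (1 - t) * u + t * v"
  have "0 \<le> t * (v - u)" "0 \<le> (1 - t) * (v - u)"
    using t uv by auto
  then have c: "u \<le> c" "c \<le> v"
    by (auto simp: c_def algebra_simps)
  have "\<bar>c - of_int n\<bar> = \<bar>(1 - t) * (u - of_int n) + t * (v - of_int n)\<bar>"
    by (simp add: c_def algebra_simps)
  also have "\<dots> \<le> \<bar>(1 - t) * (u - of_int n)\<bar> + \<bar>t * (v - of_int n)\<bar>"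
    by (rule abs_triangle_ineq)
  also have "\<dots> = (1 - t) * \<bar>u - of_int n\<bar> + t * \<bar>v - of_int n\<bar>"
    using t by (simp add: abs_mult)
  finally have "4 * \<bar>c - of_int n\<bar> - 1 \<le> (1 - t) * (4 * \<bar>u - of_int n\<bar> - 1) + t * (4 * \<bar>v - of_int n\<bar> - 1)"
    by (simp add: algebra_simps)
  then have "S (frac c) \<le> (1 - t) * S (frac u) + t * S (frac v)"
    using S[OF c] S[of u] S[of v] uv by simp
  then have "b / 2 * S (frac c) \<le> b / 2 * ((1 - t) * S (frac u) + t * S (frac v))"
    using b by (intro mult_left_mono) auto
  then show ?thesis
    unfolding c_def[symmetric] by (simp add: lift_f_def c_def algebra_simps add_divide_distrib diff_divide_distrib)
qed

section \<open>Every attracting cycle attracts the concave corner\<close>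

lemma attracting_cycle_attracts_corner:
  assumes b: "0 \<le> b" "b < 1" and C: "attracting_cycle (f a b) C"
  shows "\<exists>p>0. \<exists>x\<in>C. periodic_cycle (f a b) p C \<and>
           (\<lambda>n. ((f a b ^^ p) ^^ n) (proj_circle (1/2))) \<longlonglongrightarrow> x"
proof -
  obtain p where p: "periodic_cycle (f a b) p C"
    and attr: "\<And>x. x \<in> C \<Longrightarrow> \<exists>U. open U \<and> x \<in> U \<and>
             (\<forall>y\<in>U. (\<lambda>n. ((f a b ^^ p) ^^ n) y) \<longlonglongrightarrow> x)"
    using C by (auto simp: attracting_cycle_def)
  have p0: "0 < p"
    using p by (simp add: periodic_cycle_def)
  then obtain c where c: "c \<in> C"
    using p by (auto simp: periodic_cycle_def)
  obtain x a' where x: "c = proj_circle x" and a: "a = proj_circle a'"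
    by (metis Quotient3_abs_rep Quotient3_circle)
  define F where "F = lift_f a' b"
  have F_lift: "proj_circle ((F ^^ k) y) = (f a b ^^ k) (proj_circle y)" for k y
    by (rule proj_circle_funpow) (simp add: F_def a proj_circle_lift_f)
  have F_cont: "isCont (F ^^ k) y" for k y
    unfolding F_def by (intro isCont_funpow isCont_lift_f)
  have F_mono: "strict_mono (F ^^ k)" for k
    unfolding F_def by (intro strict_mono_funpow strict_mono_lift_f b)
  have "proj_circle ((F ^^ p) x) = proj_circle x"
    using periodic_cycle_point(1)[OF p c] by (simp add: F_lift x)
  then obtain m :: int where m: "(F ^^ p) x - x = of_int m"
    by (metis Ints_cases proj_circle_eq_iff)
  define G where "G = (\<lambda>y. (F ^^ p) y - of_int m)"
  have G_lift: "proj_circle (G y) = (f a b ^^ p) (proj_circle y)" for y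
    by (simp add: G_def F_lift)
  have G_cont: "isCont G y" for y
    unfolding G_def by (intro continuous_intros F_cont)
  have G_mono: "mono G"
    using strict_mono_mono[OF F_mono[of p]] by (simp add: G_def mono_def)
  have G_x: "G x = x"
    using m by (simp add: G_def)
  have G_shift: "G (y + of_int k) = G y + of_int (2 ^ p * k)" for y k
    unfolding G_def F_def by (simp only: funpow_lift_f_add_of_int)
  have d: "(2 :: int) \<le> 2 ^ p"
    using power_increasing[of 1 p "2 :: int"] p0 by simp
  obtain U where U: "open U" "c \<in> U" "\<And>y. y \<in> U \<Longrightarrow> (\<lambda>n. ((f a b ^^ p) ^^ n) y) \<longlonglongrightarrow> c"
    using attr[OF c] by blast
  obtain e where e: "e > 0" "\<And>y. x - e < y \<Longrightarrow> y < x \<Longrightarrow> y < G y"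
    using attracting_imp_above_diagonal[OF G_lift G_cont G_mono G_shift d G_x U(1)] U x by blast

  \<comment> \<open>Cutting off at \<open>x - e\<close> loses no point of \<open>{y. y < x \<and> G y \<le> y}\<close> and makes the set closed.\<close>
  define A where "A = {y. y \<le> x - e \<and> G y \<le> y}"
  define l where "l = Sup A"
  have A_eq: "y \<in> A \<longleftrightarrow> G y \<le> y" if "y < x" for y
    using that e(2)[of y] by (force simp: A_def)
  have "G (x - 1) = x - of_int (2 ^ p)"
    using G_shift[of x "-1"] by (simp add: G_x)
  moreover have "(2 :: real) \<le> of_int (2 ^ p)"
    using d by linarith
  ultimately have "x - 1 \<in> A"
    by (simp add: A_eq)
  then have A: "A \<noteq> {}" "bdd_above A"
    by (auto intro!: bdd_aboveI[of _ "x - e"]) (simp add: A_def)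
  have "closed A"
    unfolding A_def
    by (intro closed_Collect_conj closed_Collect_le continuous_intros
        continuous_at_imp_continuous_on ballI G_cont)
  then have "l \<in> A"
    unfolding l_def using A by (intro closed_contains_Sup)
  then have lx: "l < x" and Gl: "G l \<le> l"
    using e(1) by (auto simp: A_def)
  have above: "y < G y" if "l < y" "y < x" for y
    using cSup_upper[OF _ A(2), of y] that A_eq[of y] by (force simp: l_def)

  have "\<exists>k<p. \<exists>n. (F ^^ k) l < of_int n + 1/2 \<and> of_int n + 1/2 < (F ^^ k) x"
  proof (rule ccontr)
    assume none: "\<not> ?thesis"
    \<comment> \<open>The chord at any interior point contradicts \<open>above\<close>; the midpoint will do.\<close>
    define y where "y = (1 - 1/2) * l + 1/2 * x"
    have "(F ^^ p) y \<le> (1 - 1/2) * (F ^^ p) l + 1/2 * (F ^^ p) x"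
      unfolding y_def
    proof (rule funpow_below_chord)
      show "mono F"
        using strict_mono_mono[OF F_mono[of 1]] by simp
      fix k assume k: "k < p"
      have "(F ^^ k) l \<le> (F ^^ k) x"
        using strict_mono_mono[OF F_mono] lx by (simp add: monoD)
      then show "F ((1 - 1/2) * (F ^^ k) l + 1/2 * (F ^^ k) x)
          \<le> (1 - 1/2) * F ((F ^^ k) l) + 1/2 * F ((F ^^ k) x)"
        unfolding F_def using none k b(1) by (intro lift_f_below_chord) (auto simp: F_def)
    qed auto
    then have "G y \<le> (1 - 1/2) * G l + 1/2 * G x"
      by (simp add: G_def algebra_simps)
    then have "G y \<le> y"
      using Gl G_x by (simp add: y_def)
    moreover have "l < y" "y < x"
      using lx by (simp_all add: y_def)
    ultimately show False
      using above[of y] by simp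
  qed
  then obtain k n where corner: "(F ^^ k) l < of_int n + 1/2" "of_int n + 1/2 < (F ^^ k) x"
    by blast
  have "continuous_on {l..x} (F ^^ k)"
    by (simp add: continuous_at_imp_continuous_on F_cont)
  then obtain y where y: "l \<le> y" "y \<le> x" "(F ^^ k) y = of_int n + 1/2"
    using IVT'[of "F ^^ k" l "of_int n + 1/2" x] corner lx by auto
  then have y': "l < y" "y < x"
    using corner by (auto simp: order.order_iff_strict)
  have "(\<lambda>i. (G ^^ i) y) \<longlonglongrightarrow> x"
    using G_cont G_mono G_x above y' by (rule funpow_tendsto_next_fixed_point)
  then have "(\<lambda>i. (F ^^ k) ((G ^^ i) y)) \<longlonglongrightarrow> (F ^^ k) x"
    by (rule isCont_tendsto_compose[OF F_cont])
  then have "(\<lambda>i. proj_circle ((F ^^ k) ((G ^^ i) y))) \<longlonglongrightarrow> proj_circle ((F ^^ k) x)"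
    by (rule tendsto_proj_circle)
  moreover have "proj_circle ((F ^^ k) ((G ^^ i) y)) = ((f a b ^^ p) ^^ i) (proj_circle (1/2))" for i
  proof -
    have "proj_circle ((F ^^ k) ((G ^^ i) y)) = (f a b ^^ k) (((f a b ^^ p) ^^ i) (proj_circle y))"
      by (simp add: F_lift proj_circle_funpow[of G, OF G_lift])
    also have "\<dots> = ((f a b ^^ p) ^^ i) ((f a b ^^ k) (proj_circle y))"
      by (metis add.commute comp_apply funpow_add funpow_mult)
    also have "(f a b ^^ k) (proj_circle y) = proj_circle (1/2)"
      by (simp add: y(3) proj_circle_eq_iff flip: F_lift)
    finally show ?thesis .
  qed
  moreover have "proj_circle ((F ^^ k) x) \<in> C"
    using periodic_cycle_point(2)[OF p c] by (simp add: F_lift x)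
  ultimately show ?thesis
    using p p0 by auto
qed

theorem theorem3p3:
  fixes a :: circle and b :: real
  assumes "(a, b) \<in> hyperbolic_set"
  shows "\<exists>!C. attracting_cycle (f a b) C"
proof (rule ex_ex1I)
  show "\<exists>C. attracting_cycle (f a b) C"
    using assms by (simp add: hyperbolic_set_def)
next
  fix C D
  assume CD: "attracting_cycle (f a b) C" "attracting_cycle (f a b) D"
  have b: "0 \<le> b" "b < 1"
    using assms by (simp_all add: hyperbolic_set_def)
  obtain p x where p: "0 < p" "periodic_cycle (f a b) p C" "x \<in> C"
      "(\<lambda>n. ((f a b ^^ p) ^^ n) (proj_circle (1/2))) \<longlonglongrightarrow> x"
    using attracting_cycle_attracts_corner[OF b CD(1)] by blast
  obtain q y where q: "0 < q" "periodic_cycle (f a b) q D" "y \<in> D"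
      "(\<lambda>n. ((f a b ^^ q) ^^ n) (proj_circle (1/2))) \<longlonglongrightarrow> y"
    using attracting_cycle_attracts_corner[OF b CD(2)] by blast
  \<comment> \<open>The two limits are taken along multiples of different periods; the common multiples
    belong to both.\<close>
  have "(\<lambda>n. (f a b ^^ (p * (q * n))) (proj_circle (1/2))) \<longlonglongrightarrow> x"
    using LIMSEQ_subseq_LIMSEQ[OF p(4), of "\<lambda>n. q * n"] q(1)
    by (simp add: comp_def strict_mono_def funpow_mult)
  moreover have "(\<lambda>n. (f a b ^^ (p * (q * n))) (proj_circle (1/2))) \<longlonglongrightarrow> y"
    using LIMSEQ_subseq_LIMSEQ[OF q(4), of "\<lambda>n. p * n"] p(1)
    by (simp add: comp_def strict_mono_def funpow_mult mult.left_commute)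
  ultimately have "x = y"
    by (rule circle_limit_unique)
  then show "C = D"
    using periodic_cycle_point(2)[OF p(2,3)] periodic_cycle_point(2)[OF q(2,3)] by simp
qed

end
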